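(* Let $\mathbf u^0\in\mathbb R^{n_x\times N}$, $\mathbf u^0=\mathbf X^0\mathbf S^0\mathbf V^{0,\top}$, denote the discretized low-rank approximation of the particle density at time $t_0$, and let $\mathbf u^1=\widehat{\mathbf X}^1\widehat{\mathbf S}^1\widehat{\mathbf V}^{1,\top}\in\mathbb R^{n_x\times N}$ denote the (basis-augmented, not yet truncated) low-rank approximation at time $t_1=t_0+\Delta t$ computed by the naive IMEX scheme defined in the context. Let $\mathbf B^0,\mathbf B^1\in\mathbb R^{n_x}$ be the discretized internal energies at $t_0$ and $t_1$ (the latter computed by the same scheme), and let $E^n=\frac12\|\mathbf u^n\|_F^2+\frac12\|\mathbf B^n\|_E^2$ for $n\in\{0,1\}$ be the total energies. Then there exist initial value pairs $(\mathbf u^0,\mathbf B^0)$ and time step sizes $\Delta t>0$ such that the naive IMEX scheme results in $(\mathbf u^1,\mathbf B^1)$ for which the total energy increases, i.e. $E^1>E^0$.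
   Context: Parameters: $n_x$ is the number of spatial cells, $N$ the number of angular moments (moment indices run over $0,\dots,N-1$), $\Delta x>0$ the grid spacing, $\sigma>0$ the constant opacity, $r$ the rank with $2r\le\min(n_x,N)$. $\|\cdot\|_F$ is the Frobenius norm and $\|\cdot\|_E$ the Euclidean norm. $\mathbf e_1\in\mathbb R^N$ is the first unit vector (corresponding to moment index $0$). Angular matrices: $P_0,\dots,P_{N-1}$ are the Legendre polynomials normalized in $L^2([-1,1])$; $\mathbf A\in\mathbb R^{N\times N}$ is the symmetric matrix with entries $A_{mn}=\int_{-1}^1 P_m(\mu)\,\mu\,P_n(\mu)\,d\mu$; with an orthogonal diagonalization $\mathbf A=\mathbf Q\mathbf M\mathbf Q^\top$, set $|\mathbf A|=\mathbf Q|\mathbf M|\mathbf Q^\top$. Spatial stencil matrices in $\mathbb R^{n_x\times n_x}$ with periodic boundary conditions (indices modulo $n_x$): $D^x_{p,p\pm1}=\frac{\pm1}{2\Delta x}$; $D^{xx}_{p,p}=-\frac1{\Delta x}$, $D^{xx}_{p,p\pm1}=\frac1{2\Delta x}$; all other entries are zero. Naive IMEX scheme (one step). Given $\mathbf X^0\in\mathbb R^{n_x\times r}$ and $\mathbf V^0\in\mathbb R^{N\times r}$ with orthonormal columns, $\mathbf S^0\in\mathbb R^{r\times r}$, $\mathbf B^0\in\mathbb R^{n_x}$, put $\mathbf K^0=\mathbf X^0\mathbf S^0$, $\mathbf L^0=\mathbf V^0\mathbf S^{0,\top}$. 1. $\mathbf K^1\in\mathbb R^{n_x\times r}$ solves $\mathbf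 K^1=\mathbf K^0-\Delta t\,\mathbf D^x\mathbf K^0\mathbf V^{0,\top}\mathbf A\mathbf V^0+\Delta t\,\mathbf D^{xx}\mathbf K^0\mathbf V^{0,\top}|\mathbf A|\mathbf V^0+\sigma\Delta t(\mathbf B^0\mathbf e_1^\top\mathbf V^0-\mathbf K^1)$. 2. $\mathbf L^1\in\mathbb R^{N\times r}$ solves $\mathbf L^1=\mathbf L^0-\Delta t\,\mathbf A\mathbf L^0\mathbf X^{0,\top}(\mathbf D^x)^\top\mathbf X^0+\Delta t\,|\mathbf A|\mathbf L^0\mathbf X^{0,\top}(\mathbf D^{xx})^\top\mathbf X^0+\sigma\Delta t(\mathbf e_1\mathbf B^{0,\top}\mathbf X^0-\mathbf L^1)$. 3. $\widehat{\mathbf X}^1\in\mathbb R^{n_x\times2r}$ and $\widehat{\mathbf V}^1\in\mathbb R^{N\times2r}$ are the orthonormal factors of QR-decompositions of $[\mathbf K^1,\mathbf X^0]$ and $[\mathbf L^1,\mathbf V^0]$, respectively (they have orthonormal columns whose span contains the columns of the decomposed matrix). 4. With $\widetilde{\mathbf S}^0=\widehat{\mathbf X}^{1,\top}\mathbf X^0\mathbf S^0\mathbf V^{0,\top}\widehat{\mathbf V}^1$, $\widehat{\mathbf S}^1\in\mathbb R^{2r\times2r}$ solves $\widehat{\mathbf S}^1=\widetilde{\mathbf S}^0-\Delta t\,\widehat{\mathbf X}^{1,\top}\mathbf D^x\widehat{\mathbf X}^1\widetilde{\mathbf S}^0\widehat{\mathbf V}^{1,\top}\mathbf A\widehat{\mathbf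 V}^1+\Delta t\,\widehat{\mathbf X}^{1,\top}\mathbf D^{xx}\widehat{\mathbf X}^1\widetilde{\mathbf S}^0\widehat{\mathbf V}^{1,\top}|\mathbf A|\widehat{\mathbf V}^1+\sigma\Delta t(\widehat{\mathbf X}^{1,\top}\mathbf B^0\mathbf e_1^\top\widehat{\mathbf V}^1-\widehat{\mathbf S}^1)$. 5. $\mathbf B^1\in\mathbb R^{n_x}$ solves $\mathbf B^1=\mathbf B^0+\sigma\Delta t(\widehat{\mathbf X}^1\widehat{\mathbf S}^1\widehat{\mathbf V}^{1,\top}\mathbf e_1-\mathbf B^1)$. *)

theory Defs
  imports
    "HOL-Analysis.Henstock_Kurzweil_Integration"
    "HOL-Computational_Algebra.Polynomial"
    "Jordan_Normal_Form.Matrix"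
begin

text \<open>Matrices and vectors are those of \<open>Jordan_Normal_Form\<close>: dimensions are natural
  numbers and all indices are 0-based. The infix \<open>$\<close> below is the component of such a vector,
  so the syntax of type-indexed vectors is switched off.\<close>

unbundle no vec_syntax

definition frobenius_norm :: "real mat \<Rightarrow> real" where
  "frobenius_norm M = sqrt (\<Sum>i<dim_row M. \<Sum>j<dim_col M. (M $$ (i,j))\<^sup>2)"

definition euclidean_norm :: "real vec \<Rightarrow> real" where
  "euclidean_norm v = sqrt (\<Sum>i<dim_vec v. (v $ i)\<^sup>2)"

text \<open>\<open>outer_prod v w\<close> is the rank-one matrix $v w^T$.\<close>

definition outer_prod :: "real vec \<Rightarrow> real vec \<Rightarrow> real mat" where
  "outer_prod v w = mat (dim_vec v) (dim_vec w) (\<lambda>(i,j). v $ i * w $ j)"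

definition append_columns :: "real mat \<Rightarrow> real mat \<Rightarrow> real mat" where
  "append_columns K X = mat_of_cols (dim_row K) (cols K @ cols X)"

definition orthonormal_cols :: "real mat \<Rightarrow> bool" where
  "orthonormal_cols X \<longleftrightarrow> transpose_mat X * X = 1\<^sub>m (dim_col X)"

text \<open>\<open>Q\<close> is the orthonormal factor of some reduced QR decomposition of \<open>M\<close>. No
  sign convention is imposed on the diagonal of \<open>R\<close>, and \<open>M\<close> may be rank deficient; so \<open>Q\<close> need
  not be determined by \<open>M\<close>.\<close>

definition is_qr_factor :: "real mat \<Rightarrow> real mat \<Rightarrow> bool" where
  "is_qr_factor M Q \<longleftrightarrow>
     Q \<in> carrier_mat (dim_row M) (dim_col M) \<and> orthonormal_cols Q \<and>
     (\<exists>R. R \<in> carrier_mat (dim_col M) (dim_col M) \<and> upper_triangular R \<and> M = Q * R)"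

text \<open>Classical Legendre polynomials by Rodrigues' formula, and their normalization in
  $L^2([-1,1])$.\<close>

definition legendre :: "nat \<Rightarrow> real poly" where
  "legendre n = Polynomial.smult (1 / (2 ^ n * fact n)) ((pderiv ^^ n) ([:-1, 0, 1:] ^ n))"

definition normalized_legendre :: "nat \<Rightarrow> real poly" where
  "normalized_legendre n =
     Polynomial.smult (1 / sqrt (integral {-1..1} (\<lambda>\<mu>. (poly (legendre n) \<mu>)\<^sup>2))) (legendre n)"

definition angular_mat :: "nat \<Rightarrow> real mat" where
  "angular_mat N = mat N N (\<lambda>(m,n).
     integral {-1..1} (\<lambda>\<mu>. poly (normalized_legendre m) \<mu> * \<mu> * poly (normalized_legendre n) \<mu>))"

definition orthogonal_diagonalization :: "real mat \<Rightarrow> real mat \<Rightarrow> real mat \<Rightarrow> bool" where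
  "orthogonal_diagonalization A Q M \<longleftrightarrow>
     Q \<in> carrier_mat (dim_row A) (dim_row A) \<and> M \<in> carrier_mat (dim_row A) (dim_row A) \<and>
     orthonormal_cols Q \<and> diagonal_mat M \<and> A = Q * M * transpose_mat Q"

text \<open>$Q\,|M|\,Q^T$; the entrywise absolute value is the right one since \<open>M\<close> is diagonal
  wherever this is used.\<close>

definition abs_from_diagonalization :: "real mat \<Rightarrow> real mat \<Rightarrow> real mat" where
  "abs_from_diagonalization Q M = Q * map_mat abs M * transpose_mat Q"

text \<open>Periodic central-difference stencils. The neighbours of cell \<open>p\<close> are the cells \<open>q\<close> with
  \<open>q = (p + 1) mod nx\<close> and with \<open>p = (q + 1) mod nx\<close>. For \<open>nx = 2\<close> both neighbours coincide and
  their contributions are added, as they are in the difference quotients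
  $(u_{p+1}-u_{p-1})/(2\Delta x)$ and $(u_{p+1}-2u_p+u_{p-1})/(2\Delta x)$.\<close>

definition Dx_mat :: "nat \<Rightarrow> real \<Rightarrow> real mat" where
  "Dx_mat nx dx = mat nx nx (\<lambda>(p,q).
     (if q = (p + 1) mod nx then 1 / (2 * dx) else 0)
     + (if p = (q + 1) mod nx then - 1 / (2 * dx) else 0))"

definition Dxx_mat :: "nat \<Rightarrow> real \<Rightarrow> real mat" where
  "Dxx_mat nx dx = mat nx nx (\<lambda>(p,q).
     (if q = p then - 1 / dx else 0)
     + (if q = (p + 1) mod nx then 1 / (2 * dx) else 0)
     + (if p = (q + 1) mod nx then 1 / (2 * dx) else 0))"

text \<open>\<open>A\<close>, \<open>absA\<close> are the angular matrices, \<open>D\<close>, \<open>DD\<close> the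
  first- and second-order stencils; the unknown of each implicit equation is the last
  argument and occurs on both sides.\<close>

definition K_step ::
  "real mat \<Rightarrow> real mat \<Rightarrow> real mat \<Rightarrow> real mat \<Rightarrow> real \<Rightarrow> real
    \<Rightarrow> real mat \<Rightarrow> real mat \<Rightarrow> real mat \<Rightarrow> real vec \<Rightarrow> real mat \<Rightarrow> bool" where
  "K_step A absA D DD \<sigma> dt X0 S0 V0 B0 K1 \<longleftrightarrow>
     (let K0 = X0 * S0; e1 = unit_vec (dim_row V0) 0 in
        K1 \<in> carrier_mat (dim_row X0) (dim_col X0) \<and>
        K1 = K0 - dt \<cdot>\<^sub>m (D * K0 * transpose_mat V0 * A * V0)
                + dt \<cdot>\<^sub>m (DD * K0 * transpose_mat V0 * absA * V0)
                + (\<sigma> * dt) \<cdot>\<^sub>m (outer_prod B0 e1 * V0 - K1))"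

definition L_step ::
  "real mat \<Rightarrow> real mat \<Rightarrow> real mat \<Rightarrow> real mat \<Rightarrow> real \<Rightarrow> real
    \<Rightarrow> real mat \<Rightarrow> real mat \<Rightarrow> real mat \<Rightarrow> real vec \<Rightarrow> real mat \<Rightarrow> bool" where
  "L_step A absA D DD \<sigma> dt X0 S0 V0 B0 L1 \<longleftrightarrow>
     (let L0 = V0 * transpose_mat S0; e1 = unit_vec (dim_row V0) 0 in
        L1 \<in> carrier_mat (dim_row V0) (dim_col V0) \<and>
        L1 = L0 - dt \<cdot>\<^sub>m (A * L0 * transpose_mat X0 * transpose_mat D * X0)
                + dt \<cdot>\<^sub>m (absA * L0 * transpose_mat X0 * transpose_mat DD * X0)
                + (\<sigma> * dt) \<cdot>\<^sub>m (outer_prod e1 B0 * X0 - L1))"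

definition S_step ::
  "real mat \<Rightarrow> real mat \<Rightarrow> real mat \<Rightarrow> real mat \<Rightarrow> real \<Rightarrow> real
    \<Rightarrow> real mat \<Rightarrow> real mat \<Rightarrow> real mat \<Rightarrow> real vec
    \<Rightarrow> real mat \<Rightarrow> real mat \<Rightarrow> real mat \<Rightarrow> bool" where
  "S_step A absA D DD \<sigma> dt X0 S0 V0 B0 X1 V1 S1 \<longleftrightarrow>
     (let St = transpose_mat X1 * X0 * S0 * transpose_mat V0 * V1; e1 = unit_vec (dim_row V0) 0 in
        S1 \<in> carrier_mat (dim_col X1) (dim_col V1) \<and>
        S1 = St - dt \<cdot>\<^sub>m (transpose_mat X1 * D * X1 * St * transpose_mat V1 * A * V1)
                + dt \<cdot>\<^sub>m (transpose_mat X1 * DD * X1 * St * transpose_mat V1 * absA * V1)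
                + (\<sigma> * dt) \<cdot>\<^sub>m (transpose_mat X1 * outer_prod B0 e1 * V1 - S1))"

definition B_step ::
  "real \<Rightarrow> real \<Rightarrow> real vec \<Rightarrow> real mat \<Rightarrow> real vec \<Rightarrow> bool" where
  "B_step \<sigma> dt B0 u1 B1 \<longleftrightarrow>
     B1 \<in> carrier_vec (dim_vec B0) \<and>
     B1 = B0 + (\<sigma> * dt) \<cdot>\<^sub>v (u1 *\<^sub>v unit_vec (dim_col u1) 0 - B1)"

text \<open>\<open>naive_imex nx N dx \<sigma> dt Q M X0 S0 V0 B0 u1 B1\<close>: one step started from the factors
  \<open>X0\<close>, \<open>S0\<close>, \<open>V0\<close> and from \<open>B0\<close> can result in \<open>(u1, B1)\<close>. It is a relation because of the
  freedom in the QR decompositions. \<open>Q\<close>, \<open>M\<close> diagonalize the angular matrix.\<close>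

definition naive_imex ::
  "nat \<Rightarrow> nat \<Rightarrow> real \<Rightarrow> real \<Rightarrow> real \<Rightarrow> real mat \<Rightarrow> real mat
    \<Rightarrow> real mat \<Rightarrow> real mat \<Rightarrow> real mat \<Rightarrow> real vec \<Rightarrow> real mat \<Rightarrow> real vec \<Rightarrow> bool" where
  "naive_imex nx N dx \<sigma> dt Q M X0 S0 V0 B0 u1 B1 \<longleftrightarrow>
     (let A = angular_mat N; absA = abs_from_diagonalization Q M;
          D = Dx_mat nx dx; DD = Dxx_mat nx dx in
      \<exists>K1 L1 X1 V1 S1.
        K_step A absA D DD \<sigma> dt X0 S0 V0 B0 K1 \<and>
        L_step A absA D DD \<sigma> dt X0 S0 V0 B0 L1 \<and>
        is_qr_factor (append_columns K1 X0) X1 \<and>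
        is_qr_factor (append_columns L1 V0) V1 \<and>
        S_step A absA D DD \<sigma> dt X0 S0 V0 B0 X1 V1 S1 \<and>
        u1 = X1 * S1 * transpose_mat V1 \<and>
        B_step \<sigma> dt B0 u1 B1)"

definition total_energy :: "real mat \<Rightarrow> real vec \<Rightarrow> real" where
  "total_energy u B = (frobenius_norm u)\<^sup>2 / 2 + (euclidean_norm B)\<^sup>2 / 2"

end

theory Submission
  imports Defs
begin

unbundle no inner_syntax

text \<open>Take \<open>x\<close> to be the spatially constant unit vector, so that both stencils annihilate it. For
  \<open>u\<^sup>0 = x e\<^sub>1\<^sup>T\<close> and \<open>B\<^sup>0 = 2x\<close> all transport terms vanish, and since the augmented bases
  reproduce \<open>x\<close> and \<open>e\<^sub>1\<close> whatever QR factors are chosen, the step reduces to the scalar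
  scheme \<open>k = (1 + sb)/(1 + s)\<close>, \<open>b' = (b + sk)/(1 + s)\<close> with \<open>s = \<sigma>\<Delta>t\<close> and \<open>b = 2\<close>. For
  \<open>s = 1\<close> this gives \<open>k = 3/2\<close>, \<open>b' = 7/4\<close>, and \<open>k\<^sup>2 + b'\<^sup>2 = 85/16 > 5 = 1 + b\<^sup>2\<close>.\<close>

section \<open>Rank-one matrices and their norms\<close>

lemma outer_prod_carrier [simp]:
  "v \<in> carrier_vec n \<Longrightarrow> w \<in> carrier_vec m \<Longrightarrow> outer_prod v w \<in> carrier_mat n m"
  by (auto simp: outer_prod_def)

lemma dim_outer_prod [simp]:
  "dim_row (outer_prod v w) = dim_vec v" "dim_col (outer_prod v w) = dim_vec w"
  by (auto simp: outer_prod_def)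

lemma index_outer_prod [simp]:
  "i < dim_vec v \<Longrightarrow> j < dim_vec w \<Longrightarrow> outer_prod v w $$ (i,j) = v $ i * w $ j"
  by (auto simp: outer_prod_def)

lemma transpose_outer_prod: "transpose_mat (outer_prod v w) = outer_prod w v"
  by (rule eq_matI) auto

text \<open>A factor on the left acts only on the left vector. Together with the mirrored
  \<open>outer_prod_mult\<close>, this collapses every long product in the scheme that contains a
  rank-one factor, so a flux term vanishes as soon as a stencil meets a constant vector.\<close>

lemma mult_outer_prod:
  assumes "dim_col M = dim_vec v"
  shows "M * outer_prod v w = outer_prod (M *\<^sub>v v) w"
  using assms
  by (intro eq_matI) (auto simp: scalar_prod_def sum_distrib_right mult.assoc)

lemma outer_prod_mult:
  assumes "dim_row M = dim_vec w"
  shows "outer_prod v w * M = outer_prod v (transpose_mat M *\<^sub>v w)"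
  using assms
  by (intro eq_matI) (auto simp: scalar_prod_def sum_distrib_left algebra_simps)

lemma outer_prod_mult_vec:
  assumes "dim_vec w = dim_vec z"
  shows "outer_prod v w *\<^sub>v z = (w \<bullet> z) \<cdot>\<^sub>v v"
  using assms
  by (intro eq_vecI) (auto simp: scalar_prod_def sum_distrib_left sum_distrib_right algebra_simps)

lemma outer_prod_smult_left: "outer_prod (c \<cdot>\<^sub>v v) w = c \<cdot>\<^sub>m outer_prod v w"
  by (rule eq_matI) auto

lemma outer_prod_smult_right: "outer_prod v (c \<cdot>\<^sub>v w) = c \<cdot>\<^sub>m outer_prod v w"
  by (rule eq_matI) auto

lemma outer_prod_zero_left: "outer_prod (0\<^sub>v n) w = 0\<^sub>m n (dim_vec w)"
  by (rule eq_matI) auto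

text \<open>The double sum of squared entries factors into two single sums. The scalar is carried
  along because the states before and after the step are multiples of one rank-one matrix.\<close>

lemma frobenius_norm_outer_prod:
  "(frobenius_norm (c \<cdot>\<^sub>m outer_prod v w))\<^sup>2 = c\<^sup>2 * (v \<bullet> v) * (w \<bullet> w)"
proof -
  have "(frobenius_norm (c \<cdot>\<^sub>m outer_prod v w))\<^sup>2
      = (\<Sum>i<dim_vec v. \<Sum>j<dim_vec w. ((c \<cdot>\<^sub>m outer_prod v w) $$ (i,j))\<^sup>2)"
    unfolding frobenius_norm_def by (subst real_sqrt_pow2) (auto intro!: sum_nonneg)
  also have "\<dots> = (\<Sum>i<dim_vec v. \<Sum>j<dim_vec w. c\<^sup>2 * (v $ i * v $ i) * (w $ j * w $ j))"
    by (intro sum.cong) (auto simp: power2_eq_square)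
  also have "\<dots> = c\<^sup>2 * (v \<bullet> v) * (w \<bullet> w)"
    unfolding scalar_prod_def lessThan_atLeast0 mult.assoc sum_product
    by (simp add: sum_distrib_left)
  finally show ?thesis .
qed

lemma euclidean_norm_smult:
  "(euclidean_norm (c \<cdot>\<^sub>v v))\<^sup>2 = c\<^sup>2 * (v \<bullet> v)"
proof -
  have "(euclidean_norm (c \<cdot>\<^sub>v v))\<^sup>2 = (\<Sum>i<dim_vec v. ((c \<cdot>\<^sub>v v) $ i)\<^sup>2)"
    unfolding euclidean_norm_def by (subst real_sqrt_pow2) (auto intro!: sum_nonneg)
  also have "\<dots> = (\<Sum>i<dim_vec v. c\<^sup>2 * (v $ i * v $ i))"
    by (intro sum.cong) (auto simp: power2_eq_square)
  also have "\<dots> = c\<^sup>2 * (v \<bullet> v)"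
    by (simp add: scalar_prod_def sum_distrib_left lessThan_atLeast0)
  finally show ?thesis .
qed

section \<open>Orthonormal columns and completion of a unit vector\<close>

lemma orthonormal_colsD:
  assumes "orthonormal_cols X" "i < dim_col X" "j < dim_col X"
  shows "col X i \<bullet> col X j = (if i = j then 1 else 0)"
proof -
  have "(transpose_mat X * X) $$ (i,j) = 1\<^sub>m (dim_col X) $$ (i,j)"
    using assms(1) by (simp add: orthonormal_cols_def)
  then show ?thesis using assms(2,3) by simp
qed

text \<open>Injectivity of \<open>f\<close> turns \<open>f i = f j\<close> into
  \<open>i = j\<close>, so the Gram matrix stays the identity. This allows the initial basis and the
  QR factor to be cut out of one and the same orthogonal matrix.\<close>

lemma orthonormal_cols_select:
  assumes H: "orthonormal_cols H"
    and f: "\<And>j. j < m \<Longrightarrow> f j < dim_col H" "inj_on f {..<m}"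
    and X: "X = mat (dim_row H) m (\<lambda>(i,j). H $$ (i, f j))"
  shows "orthonormal_cols X"
proof -
  have col: "col X j = col H (f j)" if "j < m" for j
    using that f(1)[OF that] by (intro eq_vecI) (auto simp: X)
  have "transpose_mat X * X = 1\<^sub>m m"
  proof (rule eq_matI)
    fix i j assume ij: "i < dim_row (1\<^sub>m m :: real mat)" "j < dim_col (1\<^sub>m m :: real mat)"
    then have "(transpose_mat X * X) $$ (i,j) = col X i \<bullet> col X j"
      by (simp add: X)
    also have "\<dots> = (if f i = f j then 1 else 0)"
      using ij f(1) by (simp add: col orthonormal_colsD[OF H])
    also have "\<dots> = 1\<^sub>m m $$ (i,j)"
      using ij inj_onD[OF f(2)] by auto
    finally show "(transpose_mat X * X) $$ (i,j) = 1\<^sub>m m $$ (i,j)" .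
  qed (auto simp: X)
  then show ?thesis by (simp add: orthonormal_cols_def X)
qed

lemma exists_orthogonal_mat_with_first_col:
  fixes x :: "real vec"
  assumes x: "x \<in> carrier_vec n" "x \<bullet> x = 1" and n: "0 < n"
  shows "\<exists>H. H \<in> carrier_mat n n \<and> orthonormal_cols H \<and> col H 0 = x"
proof (cases "x = unit_vec n 0")
  case True
  then show ?thesis
    using n by (intro exI[of _ "1\<^sub>m n"]) (auto simp: orthonormal_cols_def)
next
  case False
  \<comment> \<open>Householder reflection exchanging \<open>x\<close> and the first unit vector\<close>
  define e where "e = (unit_vec n 0 :: real vec)"
  define w where "w = e - x"
  define a where "a = 1 - x $ 0"
  \<comment> \<open>Since \<open>w \<bullet> w = 2 * a\<close>, the factor \<open>1 / a\<close> is
    the usual 2 / |w|^2 of a reflection. It is legitimate because \<open>a = 0\<close> would force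
    \<open>w = 0\<close>, that is \<open>x = e\<close>, the case treated separately.\<close>
  define H where "H = 1\<^sub>m n - (1 / a) \<cdot>\<^sub>m outer_prod w w"
  have e: "e \<in> carrier_vec n" and w: "w \<in> carrier_vec n"
    using x by (auto simp: w_def e_def)
  have ee: "e \<bullet> e = 1" "e \<bullet> x = x $ 0" "x \<bullet> e = x $ 0"
    using x n by (auto simp: e_def)
  have ww: "w \<bullet> w = 2 * a"
    using e x ee by (simp add: w_def a_def minus_scalar_prod_distrib[of _ n]
        scalar_prod_minus_distrib[of _ n])
  have "a \<noteq> 0"
  proof
    assume "a = 0"
    then have "(\<Sum>i\<in>{0..<n}. w $ i * w $ i) = 0"
      using ww w by (simp add: scalar_prod_def)
    then have *: "\<forall>i\<in>{0..<n}. w $ i * w $ i = 0"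
      by (subst (asm) sum_nonneg_eq_0_iff) auto
    have "x = e"
    proof (rule eq_vecI)
      fix i assume "i < dim_vec e"
      then have i: "i < n" using e by simp
      then have "w $ i = 0" using * by simp
      then show "x $ i = e $ i" using i x e by (simp add: w_def)
    qed (use e x in auto)
    then show False using False by (simp add: e_def)
  qed
  have H: "H \<in> carrier_mat n n" using w by (auto simp: H_def)
  have ent: "H $$ (i,j) = (if i = j then 1 else 0) - w $ i * w $ j / a" if "i < n" "j < n" for i j
    using that w by (simp add: H_def)
  have "transpose_mat H * H = 1\<^sub>m n"
  proof (rule eq_matI)
    fix i j assume "i < dim_row (1\<^sub>m n :: real mat)" "j < dim_col (1\<^sub>m n :: real mat)"
    then have ij: "i < n" "j < n" by auto
    have "(transpose_mat H * H) $$ (i,j) = (\<Sum>k\<in>{0..<n}. H $$ (k,i) * H $$ (k,j))"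
      using ij H by (simp add: scalar_prod_def)
    \<comment> \<open>Expansion of (I - w w^T / a)^2. The two cross terms give -2 w w^T / a, and the
      last term gives |w|^2 w w^T / a^2 = 2 w w^T / a, which cancels them.\<close>
    also have "\<dots> = (\<Sum>k\<in>{0..<n}. (if k = i then (if i = j then 1 else 0) else 0)
        - (if k = i then w $ i * w $ j / a else 0) - (if k = j then w $ i * w $ j / a else 0)
        + w $ k * w $ k * (w $ i * w $ j / a\<^sup>2))"
      using ij by (intro sum.cong) (auto simp: ent algebra_simps power2_eq_square)
    also have "\<dots> = (if i = j then 1 else 0) - 2 * (w $ i * w $ j / a)
        + (w \<bullet> w) * (w $ i * w $ j / a\<^sup>2)"
      using ij w by (simp add: sum.distrib sum_subtractf scalar_prod_def sum_distrib_right
          sum_divide_distrib)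
    also have "\<dots> = 1\<^sub>m n $$ (i,j)"
      using ij \<open>a \<noteq> 0\<close> by (simp add: ww power2_eq_square)
    finally show "(transpose_mat H * H) $$ (i,j) = 1\<^sub>m n $$ (i,j)" .
  qed (use H in auto)
  moreover have "col H 0 = x"
  proof (rule eq_vecI)
    fix i assume "i < dim_vec x"
    then have i: "i < n" using x by simp
    \<comment> \<open>Hence the first column of \<open>H\<close> is e - (a / a) w = e - w =
      x.\<close>
    have "w $ 0 = a" using n x by (simp add: w_def a_def e_def)
    then show "col H 0 $ i = x $ i"
      using i n H x \<open>a \<noteq> 0\<close> by (auto simp: ent w_def e_def)
  qed (use H x in auto)
  ultimately show ?thesis
    using H by (intro exI[of _ H]) (auto simp: orthonormal_cols_def)
qed

section \<open>QR factors of augmented bases\<close>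

lemma append_columns_carrier:
  assumes "K \<in> carrier_mat n r" "X \<in> carrier_mat n r'"
  shows "append_columns K X \<in> carrier_mat n (r + r')"
  using assms by (auto simp: append_columns_def)

lemma index_append_columns:
  assumes "K \<in> carrier_mat n r" "X \<in> carrier_mat n r'" "i < n" "j < r + r'"
  shows "append_columns K X $$ (i,j) = (if j < r then K $$ (i,j) else X $$ (i, j - r))"
  using assms by (auto simp: append_columns_def mat_of_cols_index nth_append)

text \<open>The block \<open>X\<close> consists of the last columns of \<open>W * R\<close>, so its
  columns lie in the range of \<open>W\<close>, on which the projection W W^T is the identity. This
  holds for every admissible factor \<open>W\<close>, which is what makes the outcome of the step
  independent of the QR choice.\<close>

lemma qr_factor_projection:
  assumes K: "K \<in> carrier_mat n r" and X: "X \<in> carrier_mat n r'"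
    and qr: "is_qr_factor (append_columns K X) W"
  shows "W \<in> carrier_mat n (r + r')" "W * (transpose_mat W * X) = X"
proof -
  note KX = append_columns_carrier[OF K X]
  show W: "W \<in> carrier_mat n (r + r')"
    using qr KX by (auto simp: is_qr_factor_def)
  from qr obtain R where R: "R \<in> carrier_mat (r + r') (r + r')"
    and eq: "append_columns K X = W * R"
    using KX by (auto simp: is_qr_factor_def)
  have o: "transpose_mat W * W = 1\<^sub>m (r + r')"
    using qr W by (auto simp: is_qr_factor_def orthonormal_cols_def)
  define R' where "R' = mat (r + r') r' (\<lambda>(i,j). R $$ (i, r + j))"
  have R': "R' \<in> carrier_mat (r + r') r'" by (auto simp: R'_def)
  have XW: "X = W * R'"
  proof (rule eq_matI)
    fix i j assume "i < dim_row (W * R')" "j < dim_col (W * R')"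
    then have ij: "i < n" "j < r'" using W R' by auto
    have "X $$ (i,j) = (W * R) $$ (i, r + j)"
      using ij index_append_columns[OF K X, of i "r + j"] by (simp add: eq)
    also have "\<dots> = row W i \<bullet> col R (r + j)" using ij W R by simp
    also have "col R (r + j) = col R' j"
      using ij R by (intro eq_vecI) (auto simp: R'_def)
    finally show "X $$ (i,j) = (W * R') $$ (i,j)" using ij W R' by simp
  qed (use W R' X in auto)
  have "transpose_mat W * (W * R') = R'"
    using W R' o assoc_mult_mat[of "transpose_mat W" "r + r'" n W "r + r'" R' r'] by simp
  then show "W * (transpose_mat W * X) = X"
    by (simp only: XW)
qed

text \<open>The columns \<open>1, \<dots>, r - 1\<close> of the first block are zero, so the corresponding columns of the
  factor are free; an upper triangular \<open>R\<close> exists when \<open>2r \<le> n\<close>.\<close>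

lemma exists_orthonormal_with_qr_factor:
  fixes x :: "real vec"
  assumes x: "x \<in> carrier_vec n" "x \<bullet> x = 1" and r: "1 \<le> r" "2 * r \<le> n"
  shows "\<exists>X0. X0 \<in> carrier_mat n r \<and> orthonormal_cols X0 \<and> col X0 0 = x \<and>
    (\<forall>k. \<exists>W. is_qr_factor (append_columns (k \<cdot>\<^sub>m outer_prod x (unit_vec r 0)) X0) W)"
proof -
  obtain H where H: "H \<in> carrier_mat n n" "orthonormal_cols H" and H0: "col H 0 = x"
    using exists_orthogonal_mat_with_first_col[OF x] r by auto
  have xH: "H $$ (i,0) = x $ i" if "i < n" for i
    using that H r by (simp flip: H0)
  \<comment> \<open>\<open>X0\<close> takes column 0 of \<open>H\<close> and then columns r+1, ...,
    2r-1, so that each of its later columns has the same index in \<open>H\<close> as its position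
    in the augmented matrix.\<close>
  define f where "f j = (if j = 0 then 0 else r + j)" for j :: nat
  define X0 where "X0 = mat (dim_row H) r (\<lambda>(i,j). H $$ (i, f j))"
  define W where "W = mat (dim_row H) (2 * r) (\<lambda>(i,j). H $$ (i, j))"
  have X0: "X0 \<in> carrier_mat n r" and W: "W \<in> carrier_mat n (r + r)"
    using H by (auto simp: X0_def W_def)
  have oX0: "orthonormal_cols X0"
    by (rule orthonormal_cols_select[OF H(2) _ _ X0_def])
      (use H r in \<open>auto simp: f_def inj_on_def\<close>)
  have oW: "orthonormal_cols W"
    by (rule orthonormal_cols_select[OF H(2) _ _ W_def]) (use H r in auto)
  have cX0: "col X0 0 = x"
    using r x H by (intro eq_vecI) (auto simp: X0_def f_def xH)
  have qr: "is_qr_factor (append_columns (k \<cdot>\<^sub>m outer_prod x (unit_vec r 0)) X0) W" for k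
  proof -
    let ?K = "k \<cdot>\<^sub>m outer_prod x (unit_vec r 0)"
    have K: "?K \<in> carrier_mat n r" using x by simp
    note KX = append_columns_carrier[OF K X0]
    \<comment> \<open>Column j of the augmented matrix is \<open>c j\<close> times column
      \<open>g j\<close> of \<open>H\<close>: first k x, then zeros, then x again at position r,
      then the remaining columns of \<open>X0\<close>. Since g j \<le> j, the resulting
      \<open>R\<close> is upper triangular.\<close>
    define g where "g j = (if j = r then 0 else j)" for j :: nat
    define c where "c j = (if j = 0 then k else if j < r then 0 else 1)" for j :: nat
    define R where "R = mat (r + r) (r + r) (\<lambda>(i,j). if i = g j then c j else 0)"
    have R: "R \<in> carrier_mat (r + r) (r + r)" by (simp add: R_def)
    have up: "upper_triangular R"
      by (auto simp: upper_triangular_def R_def g_def)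
    have "append_columns ?K X0 = W * R"
    proof (rule eq_matI)
      fix i j assume "i < dim_row (W * R)" "j < dim_col (W * R)"
      then have ij: "i < n" "j < r + r" using W R by auto
      have gj: "g j < r + r" using ij by (auto simp: g_def)
      have "(W * R) $$ (i,j) = (\<Sum>l\<in>{0..<r + r}. W $$ (i,l) * R $$ (l,j))"
        using ij W R by (simp add: scalar_prod_def)
      also have "\<dots> = (\<Sum>l\<in>{0..<r + r}. if l = g j then H $$ (i, g j) * c j else 0)"
        using ij H by (intro sum.cong) (auto simp: W_def R_def)
      also have "\<dots> = H $$ (i, g j) * c j"
        using gj by simp
      also have "\<dots> = append_columns ?K X0 $$ (i,j)"
        using ij r x H unfolding index_append_columns[OF K X0 ij]
        by (auto simp: g_def c_def X0_def f_def xH)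
      finally show "append_columns ?K X0 $$ (i,j) = (W * R) $$ (i,j)" by simp
    qed (use KX W R in auto)
    then show ?thesis
      using KX W R up oW unfolding is_qr_factor_def by auto
  qed
  show ?thesis using X0 oX0 cX0 qr by blast
qed

section \<open>Periodic stencils on constant vectors\<close>

text \<open>Modulo n, every cell has exactly one successor and exactly one predecessor, so each sum
  has a single nonzero candidate. Treating the two sums separately also covers small n, where the
  neighbours coincide.\<close>

lemma stencil_neighbours:
  assumes "p < (n::nat)"
  shows "(\<Sum>q\<in>{0..<n}. if q = (p + 1) mod n then c else 0) = (c::real)"
    and "(\<Sum>q\<in>{0..<n}. if p = (q + 1) mod n then c else 0) = (c::real)"
proof -
  show "(\<Sum>q\<in>{0..<n}. if q = (p + 1) mod n then c else 0) = c"
    using assms by simp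
  \<comment> \<open>The wrap-around: the predecessor of cell 0 is cell n - 1.\<close>
  have iff: "p = (q + 1) mod n \<longleftrightarrow> q = (if p = 0 then n - 1 else p - 1)" if "q < n" for q
    using that assms by (cases "q + 1 = n") auto
  have "(\<Sum>q\<in>{0..<n}. if p = (q + 1) mod n then c else 0)
      = (\<Sum>q\<in>{0..<n}. if q = (if p = 0 then n - 1 else p - 1) then c else 0)"
    by (intro sum.cong refl) (metis iff atLeastLessThan_iff)
  also have "\<dots> = c" using assms by (subst sum.delta) auto
  finally show "(\<Sum>q\<in>{0..<n}. if p = (q + 1) mod n then c else 0) = c" .
qed

text \<open>Each row sums to 1/(2 dx) - 1/(2 dx) = 0. For the second-order stencil below, the row
  sum is -1/dx + 1/(2 dx) + 1/(2 dx) = 0.\<close>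

lemma Dx_mat_const: "Dx_mat n dx *\<^sub>v vec n (\<lambda>_. c) = 0\<^sub>v n"
proof (rule eq_vecI)
  fix p assume "p < dim_vec (0\<^sub>v n :: real vec)"
  then have p: "p < n" by simp
  have "(Dx_mat n dx *\<^sub>v vec n (\<lambda>_. c)) $ p = (\<Sum>q\<in>{0..<n}.
      ((if q = (p + 1) mod n then 1 / (2 * dx) else 0)
     + (if p = (q + 1) mod n then - 1 / (2 * dx) else 0)) * c)"
    using p by (simp add: Dx_mat_def scalar_prod_def)
  also have "\<dots> = 0"
    using p by (simp only: sum_distrib_right[symmetric] sum.distrib stencil_neighbours[OF p]) simp
  finally show "(Dx_mat n dx *\<^sub>v vec n (\<lambda>_. c)) $ p = 0\<^sub>v n $ p" using p by simp
qed (simp add: Dx_mat_def)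

lemma Dxx_mat_const: "Dxx_mat n dx *\<^sub>v vec n (\<lambda>_. c) = 0\<^sub>v n"
proof (rule eq_vecI)
  fix p assume "p < dim_vec (0\<^sub>v n :: real vec)"
  then have p: "p < n" by simp
  have d: "(\<Sum>q\<in>{0..<n}. if q = p then - 1 / dx else 0) = - 1 / dx" using p by simp
  have "(Dxx_mat n dx *\<^sub>v vec n (\<lambda>_. c)) $ p = (\<Sum>q\<in>{0..<n}. ((if q = p then - 1 / dx else 0)
     + (if q = (p + 1) mod n then 1 / (2 * dx) else 0)
     + (if p = (q + 1) mod n then 1 / (2 * dx) else 0)) * c)"
    using p by (simp add: Dxx_mat_def scalar_prod_def)
  also have "\<dots> = 0"
    using p by (simp only: sum_distrib_right[symmetric] sum.distrib stencil_neighbours[OF p] d) simp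
  finally show "(Dxx_mat n dx *\<^sub>v vec n (\<lambda>_. c)) $ p = 0\<^sub>v n $ p" using p by simp
qed (simp add: Dxx_mat_def)

section \<open>Simplification of products and solution of the implicit equations\<close>

lemma outer_prod_zero_right: "outer_prod v (0\<^sub>v n) = 0\<^sub>m (dim_vec v) n"
  by (rule eq_matI) auto

lemma zero_mat_mult: "dim_row M = n \<Longrightarrow> 0\<^sub>m m n * M = 0\<^sub>m m (dim_col M)"
  by (rule eq_matI) (auto simp: scalar_prod_def)

lemma mult_vec_zero: "dim_col M = n \<Longrightarrow> M *\<^sub>v 0\<^sub>v n = 0\<^sub>v (dim_row M)"
  by (rule eq_vecI) (auto simp: scalar_prod_def)

text \<open>Associativity with its conditions phrased as equations between dimensions instead of
  carrier memberships, so that rewriting needs no intermediate dimension to be guessed. The two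
  scalar rules that follow have the same form.\<close>

lemma mult_mat_mult_vec:
  assumes "dim_col M = dim_row L" "dim_col L = dim_vec v"
  shows "M * L *\<^sub>v v = M *\<^sub>v (L *\<^sub>v v)"
  by (rule assoc_mult_mat_vec[OF carrier_matI[OF refl refl] carrier_matI carrier_vecI])
    (simp_all add: assms)

lemma smult_mat_mult:
  "dim_col M = dim_row L \<Longrightarrow> (c \<cdot>\<^sub>m M) * L = (c :: real) \<cdot>\<^sub>m (M * L)"
  by (rule mult_smult_assoc_mat[OF carrier_matI[OF refl refl] carrier_matI]) simp_all

lemma mult_smult_mat:
  "dim_col M = dim_row L \<Longrightarrow> M * (c \<cdot>\<^sub>m L) = (c :: real) \<cdot>\<^sub>m (M * L)"
  by (rule mult_smult_distrib[OF carrier_matI[OF refl refl] carrier_matI]) simp_all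

text \<open>Entrywise the equation is (1 + s) Y = (1 + s \<beta>) G. The zero matrices stand where
  the K, L and S equations have their flux terms, so the lemma applies to all three once these have
  collapsed. The equivalence gives solvability and uniqueness together.\<close>

lemma implicit_mat_step_iff:
  fixes G Y :: "real mat" and s :: real
  assumes "G \<in> carrier_mat n m" "Y \<in> carrier_mat n m" "1 + s \<noteq> 0"
  shows "Y = G - a \<cdot>\<^sub>m 0\<^sub>m n m + b \<cdot>\<^sub>m 0\<^sub>m n m + s \<cdot>\<^sub>m (\<beta> \<cdot>\<^sub>m G - Y)
    \<longleftrightarrow> Y = ((1 + s * \<beta>) / (1 + s)) \<cdot>\<^sub>m G" (is "_ = ?R \<longleftrightarrow> _")
proof -
  have *: "Y $$ (i,j) = ?R $$ (i,j) \<longleftrightarrow> Y $$ (i,j) = (((1 + s * \<beta>) / (1 + s)) \<cdot>\<^sub>m G) $$ (i,j)"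
    if "i < n" "j < m" for i j
    using that assms by (simp add: field_simps)
  show ?thesis
    using assms(1,2) * by (subst (1 2) mat_eq_iff) auto
qed

lemma implicit_vec_step_iff:
  fixes x Y :: "real vec" and s :: real
  assumes "x \<in> carrier_vec n" "Y \<in> carrier_vec n" "1 + s \<noteq> 0"
  shows "Y = b \<cdot>\<^sub>v x + s \<cdot>\<^sub>v (k \<cdot>\<^sub>v x - Y) \<longleftrightarrow> Y = ((b + s * k) / (1 + s)) \<cdot>\<^sub>v x"
    (is "_ = ?R \<longleftrightarrow> _")
proof -
  have *: "Y $ i = ?R $ i \<longleftrightarrow> Y $ i = (((b + s * k) / (1 + s)) \<cdot>\<^sub>v x) $ i"
    if "i < n" for i
    using that assms by (simp add: field_simps)
  show ?thesis
    using assms(1,2) * by (subst (1 2) vec_eq_iff) auto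
qed

lemma transpose_mult_first_col:
  assumes "X \<in> carrier_mat n r" "orthonormal_cols X" "col X 0 = x" "0 < r"
  shows "transpose_mat X *\<^sub>v x = unit_vec r 0"
proof -
  have "transpose_mat X *\<^sub>v col X 0 = col (transpose_mat X * X) 0"
    using assms by (intro eq_vecI) auto
  also have "\<dots> = unit_vec r 0"
    using assms by (auto simp: orthonormal_cols_def)
  finally show ?thesis using assms(3) by simp
qed

section \<open>One step started from a spatially constant state\<close>

text \<open>Because the stencils annihilate \<open>x\<close>, only absorption and emission act, and
  the step never leaves the multiples of \<open>outer_prod x e\<close> and \<open>x\<close>. The
  second claim determines the result for every QR choice; the third gives existence of a result from
  a pair of QR factors.\<close>

lemma naive_imex_equilibrium_direction:
  fixes x :: "real vec" and N r :: nat
  defines "e \<equiv> unit_vec N 0"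
  assumes x: "x \<in> carrier_vec nx"
    and D: "Dx_mat nx dx *\<^sub>v x = 0\<^sub>v nx" and DD: "Dxx_mat nx dx *\<^sub>v x = 0\<^sub>v nx"
    and Q: "Q \<in> carrier_mat N N" and M: "M \<in> carrier_mat N N"
    and X0: "X0 \<in> carrier_mat nx r" "orthonormal_cols X0" "col X0 0 = x"
    and V0: "V0 \<in> carrier_mat N r" "orthonormal_cols V0" "col V0 0 = e"
    and r: "0 < r" and N: "0 < N"
    and S0: "S0 = outer_prod (unit_vec r 0) (unit_vec r 0)"
    and s: "\<sigma> * dt > 0"
    and k: "k = (1 + \<sigma> * dt * b) / (1 + \<sigma> * dt)"
  shows "X0 * S0 * transpose_mat V0 = outer_prod x e"
    and "naive_imex nx N dx \<sigma> dt Q M X0 S0 V0 (b \<cdot>\<^sub>v x) u1 B1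
      \<Longrightarrow> u1 = k \<cdot>\<^sub>m outer_prod x e \<and> B1 = ((b + \<sigma> * dt * k) / (1 + \<sigma> * dt)) \<cdot>\<^sub>v x"
    and "is_qr_factor (append_columns (k \<cdot>\<^sub>m outer_prod x (unit_vec r 0)) X0) X1
      \<Longrightarrow> is_qr_factor (append_columns (k \<cdot>\<^sub>m outer_prod e (unit_vec r 0)) V0) V1
      \<Longrightarrow> \<exists>u1 B1. naive_imex nx N dx \<sigma> dt Q M X0 S0 V0 (b \<cdot>\<^sub>v x) u1 B1"
proof -
  define er where "er = (unit_vec r 0 :: real vec)"
  define s where "s = \<sigma> * dt"
  define A where "A = angular_mat N"
  define absA where "absA = abs_from_diagonalization Q M"
  define D where "D = Dx_mat nx dx"
  define DD where "DD = Dxx_mat nx dx"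
  have s1: "1 + s \<noteq> 0" using s by (simp add: s_def)
  have e: "e \<in> carrier_vec N" "dim_vec e = N" and er: "er \<in> carrier_vec r" "dim_vec er = r"
    by (auto simp: e_def er_def)
  have A: "A \<in> carrier_mat N N" "dim_row A = N" "dim_col A = N" and
    absA: "absA \<in> carrier_mat N N" "dim_row absA = N" "dim_col absA = N" and
    Dc: "D \<in> carrier_mat nx nx" "dim_row D = nx" "dim_col D = nx" and
    DDc: "DD \<in> carrier_mat nx nx" "dim_row DD = nx" "dim_col DD = nx"
    using Q M by (auto simp: A_def angular_mat_def absA_def abs_from_diagonalization_def
        D_def Dx_mat_def DD_def Dxx_mat_def)
  have Dx: "D *\<^sub>v x = 0\<^sub>v nx" and DDx: "DD *\<^sub>v x = 0\<^sub>v nx"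
    using D DD by (auto simp: D_def DD_def)
  have dims: "dim_vec x = nx" "dim_row X0 = nx" "dim_col X0 = r" "dim_row V0 = N" "dim_col V0 = r"
    using x X0 V0 by auto
  have X0er: "X0 *\<^sub>v er = x"
    using X0 r x by (intro eq_vecI) (auto simp: er_def)
  have V0er: "V0 *\<^sub>v er = e"
    using V0 r e by (intro eq_vecI) (auto simp: er_def)
  have X0x: "transpose_mat X0 *\<^sub>v x = er" and V0e: "transpose_mat V0 *\<^sub>v e = er"
    using transpose_mult_first_col X0 V0 r by (auto simp: er_def)
  have S0': "S0 = outer_prod er er" by (simp add: S0 er_def)
  \<comment> \<open>These rewrite each product in the scheme to a rank-one matrix with matrix-vector
    products inside. Those evaluate by X0 er = x, X0^T x = er, their angular analogues, and D x =
    0.\<close>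
  note rules = mult_outer_prod outer_prod_mult mult_mat_mult_vec X0er V0er X0x V0e Dx DDx
    outer_prod_zero_left outer_prod_zero_right zero_mat_mult mult_vec_zero transpose_outer_prod
    outer_prod_smult_left outer_prod_smult_right smult_mat_mult mult_smult_mat dims Dc(2,3) DDc(2,3) A(2,3) absA(2,3) e(2) er(2)
  show u0: "X0 * S0 * transpose_mat V0 = outer_prod x e"
    by (simp add: S0' rules)
  have K: "K_step A absA D DD \<sigma> dt X0 S0 V0 (b \<cdot>\<^sub>v x) Y \<longleftrightarrow> Y = k \<cdot>\<^sub>m outer_prod x er" for Y
  proof -
    have G: "outer_prod x er \<in> carrier_mat nx r" using x er by simp
    have "K_step A absA D DD \<sigma> dt X0 S0 V0 (b \<cdot>\<^sub>v x) Y \<longleftrightarrow> Y \<in> carrier_mat nx r \<and>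
      Y = outer_prod x er - dt \<cdot>\<^sub>m 0\<^sub>m nx r + dt \<cdot>\<^sub>m 0\<^sub>m nx r
        + s \<cdot>\<^sub>m (b \<cdot>\<^sub>m outer_prod x er - Y)"
      by (simp add: K_step_def S0' rules Let_def s_def flip: e_def)
    also have "\<dots> \<longleftrightarrow> Y = k \<cdot>\<^sub>m outer_prod x er"
      using implicit_mat_step_iff[OF G _ s1] G by (auto simp: k s_def)
    finally show ?thesis .
  qed
  have L: "L_step A absA D DD \<sigma> dt X0 S0 V0 (b \<cdot>\<^sub>v x) Y \<longleftrightarrow> Y = k \<cdot>\<^sub>m outer_prod e er" for Y
  proof -
    have G: "outer_prod e er \<in> carrier_mat N r" using e er by simp
    have "L_step A absA D DD \<sigma> dt X0 S0 V0 (b \<cdot>\<^sub>v x) Y \<longleftrightarrow> Y \<in> carrier_mat N r \<and>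
      Y = outer_prod e er - dt \<cdot>\<^sub>m 0\<^sub>m N r + dt \<cdot>\<^sub>m 0\<^sub>m N r
        + s \<cdot>\<^sub>m (b \<cdot>\<^sub>m outer_prod e er - Y)"
      by (simp add: L_step_def S0' rules Let_def s_def flip: e_def)
    also have "\<dots> \<longleftrightarrow> Y = k \<cdot>\<^sub>m outer_prod e er"
      using implicit_mat_step_iff[OF G _ s1] G by (auto simp: k s_def)
    finally show ?thesis .
  qed
  have B: "B_step \<sigma> dt (b \<cdot>\<^sub>v x) (k \<cdot>\<^sub>m outer_prod x e) Y
      \<longleftrightarrow> Y = ((b + s * k) / (1 + s)) \<cdot>\<^sub>v x" for Y
  proof -
    \<comment> \<open>As N > 0, \<open>e\<close> has length one, so moment 0 of the new density is k
      x.\<close>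
    have "(k \<cdot>\<^sub>m outer_prod x e) *\<^sub>v e = k \<cdot>\<^sub>v x"
      using N x by (simp add: outer_prod_mult_vec rules e_def flip: outer_prod_smult_left)
    then have "B_step \<sigma> dt (b \<cdot>\<^sub>v x) (k \<cdot>\<^sub>m outer_prod x e) Y
        \<longleftrightarrow> Y \<in> carrier_vec nx \<and> Y = b \<cdot>\<^sub>v x + s \<cdot>\<^sub>v (k \<cdot>\<^sub>v x - Y)"
      by (simp add: B_step_def rules s_def flip: e_def)
    also have "\<dots> \<longleftrightarrow> Y = ((b + s * k) / (1 + s)) \<cdot>\<^sub>v x"
      using implicit_vec_step_iff[OF x _ s1] x by auto
    finally show ?thesis .
  qed
  have S: "(S_step A absA D DD \<sigma> dt X0 S0 V0 (b \<cdot>\<^sub>v x) X1 V1 Y \<longleftrightarrow>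
        Y = k \<cdot>\<^sub>m outer_prod (transpose_mat X1 *\<^sub>v x) (transpose_mat V1 *\<^sub>v e)) \<and>
      X1 * (k \<cdot>\<^sub>m outer_prod (transpose_mat X1 *\<^sub>v x) (transpose_mat V1 *\<^sub>v e)) * transpose_mat V1
        = k \<cdot>\<^sub>m outer_prod x e"
    if qX: "is_qr_factor (append_columns (k \<cdot>\<^sub>m outer_prod x er) X0) X1"
      and qV: "is_qr_factor (append_columns (k \<cdot>\<^sub>m outer_prod e er) V0) V1" for X1 V1 Y
  proof -
    \<comment> \<open>\<open>p\<close> and \<open>q\<close> are the coordinates of \<open>x\<close>
      and \<open>e\<close> in the augmented bases. Since x = X0 er and e = V0 er lie in the spans of
      the old bases, the projection lemma recovers X1 p = x and V1 q = e.\<close>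
    define p where "p = transpose_mat X1 *\<^sub>v x"
    define q where "q = transpose_mat V1 *\<^sub>v e"
    have Kc: "k \<cdot>\<^sub>m outer_prod x er \<in> carrier_mat nx r" using x er by simp
    have Lc: "k \<cdot>\<^sub>m outer_prod e er \<in> carrier_mat N r" using e er by simp
    note pX = qr_factor_projection[OF Kc X0(1) qX]
    note pV = qr_factor_projection[OF Lc V0(1) qV]
    have d: "dim_row X1 = nx" "dim_col X1 = r + r" "dim_row V1 = N" "dim_col V1 = r + r"
      "dim_vec p = r + r" "dim_vec q = r + r"
      using pX(1) pV(1) by (auto simp: p_def q_def)
    have "X1 *\<^sub>v p = X1 * (transpose_mat X1 * X0) *\<^sub>v er"
      by (simp add: rules d p_def)
    then have Xp: "X1 *\<^sub>v p = x" by (simp add: pX(2) X0er)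
    have "V1 *\<^sub>v q = V1 * (transpose_mat V1 * V0) *\<^sub>v er"
      by (simp add: rules d q_def)
    then have Vq: "V1 *\<^sub>v q = e" by (simp add: pV(2) V0er)
    have G: "outer_prod p q \<in> carrier_mat (r + r) (r + r)"
      by (rule outer_prod_carrier; rule carrier_vecI; rule d)
    have St: "transpose_mat X1 * X0 * S0 * transpose_mat V0 * V1 = outer_prod p q"
      by (simp add: S0' rules d flip: p_def q_def)
    have src: "transpose_mat X1 * outer_prod (b \<cdot>\<^sub>v x) e * V1 = b \<cdot>\<^sub>m outer_prod p q"
      by (simp add: rules d flip: p_def q_def)
    \<comment> \<open>The inner product X1 p is \<open>x\<close> again, so the projected stencils
      still act on a constant vector and both fluxes vanish.\<close>
    have flux: "transpose_mat X1 * D * X1 * outer_prod p q * transpose_mat V1 * A * V1 = 0\<^sub>m (r + r) (r + r)"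
      "transpose_mat X1 * DD * X1 * outer_prod p q * transpose_mat V1 * absA * V1 = 0\<^sub>m (r + r) (r + r)"
      by (simp_all add: rules d Xp)
    have "S_step A absA D DD \<sigma> dt X0 S0 V0 (b \<cdot>\<^sub>v x) X1 V1 Y \<longleftrightarrow> Y \<in> carrier_mat (r + r) (r + r) \<and>
      Y = outer_prod p q - dt \<cdot>\<^sub>m 0\<^sub>m (r + r) (r + r) + dt \<cdot>\<^sub>m 0\<^sub>m (r + r) (r + r)
        + s \<cdot>\<^sub>m (b \<cdot>\<^sub>m outer_prod p q - Y)"
      unfolding S_step_def Let_def dims(4) e_def[symmetric] St src flux d s_def ..
    also have "\<dots> \<longleftrightarrow> Y = k \<cdot>\<^sub>m outer_prod p q"
      using implicit_mat_step_iff[OF G _ s1] G by (auto simp: k s_def)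
    finally show ?thesis
      using Vq Xp d by (simp add: rules flip: p_def q_def)
  qed
  \<comment> \<open>\<open>K\<close> and \<open>L\<close> are equivalences, so the existential
    quantifiers over the K and L solutions are eliminated by substitution. Only the freedom in the
    QR factors remains.\<close>
  have step: "naive_imex nx N dx \<sigma> dt Q M X0 S0 V0 (b \<cdot>\<^sub>v x) u1 B1 \<longleftrightarrow>
    (\<exists>X1 V1 S1. is_qr_factor (append_columns (k \<cdot>\<^sub>m outer_prod x er) X0) X1 \<and>
      is_qr_factor (append_columns (k \<cdot>\<^sub>m outer_prod e er) V0) V1 \<and>
      S_step A absA D DD \<sigma> dt X0 S0 V0 (b \<cdot>\<^sub>v x) X1 V1 S1 \<and>
      u1 = X1 * S1 * transpose_mat V1 \<and> B_step \<sigma> dt (b \<cdot>\<^sub>v x) u1 B1)" for u1 B1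
    unfolding naive_imex_def Let_def A_def[symmetric] absA_def[symmetric] D_def[symmetric]
      DD_def[symmetric] K L by blast
  show "u1 = k \<cdot>\<^sub>m outer_prod x e \<and> B1 = ((b + \<sigma> * dt * k) / (1 + \<sigma> * dt)) \<cdot>\<^sub>v x"
    if "naive_imex nx N dx \<sigma> dt Q M X0 S0 V0 (b \<cdot>\<^sub>v x) u1 B1"
  proof -
    from that obtain X1 V1 S1 where
      q: "is_qr_factor (append_columns (k \<cdot>\<^sub>m outer_prod x er) X0) X1"
        "is_qr_factor (append_columns (k \<cdot>\<^sub>m outer_prod e er) V0) V1"
      and S1: "S_step A absA D DD \<sigma> dt X0 S0 V0 (b \<cdot>\<^sub>v x) X1 V1 S1"
      and u1: "u1 = X1 * S1 * transpose_mat V1" and B1: "B_step \<sigma> dt (b \<cdot>\<^sub>v x) u1 B1"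
      unfolding step by blast
    have u1': "u1 = k \<cdot>\<^sub>m outer_prod x e"
      using S[OF q, of S1] S1 unfolding u1 by auto
    with B1 B show ?thesis by (simp only: s_def)
  qed
  show "\<exists>u1 B1. naive_imex nx N dx \<sigma> dt Q M X0 S0 V0 (b \<cdot>\<^sub>v x) u1 B1"
    if q: "is_qr_factor (append_columns (k \<cdot>\<^sub>m outer_prod x (unit_vec r 0)) X0) X1"
      "is_qr_factor (append_columns (k \<cdot>\<^sub>m outer_prod e (unit_vec r 0)) V0) V1"
  proof -
    note q = q[folded er_def]
    define S1 where
      "S1 = k \<cdot>\<^sub>m outer_prod (transpose_mat X1 *\<^sub>v x) (transpose_mat V1 *\<^sub>v e)"
    define B1 where "B1 = ((b + s * k) / (1 + s)) \<cdot>\<^sub>v x"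
    have Sst: "S_step A absA D DD \<sigma> dt X0 S0 V0 (b \<cdot>\<^sub>v x) X1 V1 S1"
      and u1: "X1 * S1 * transpose_mat V1 = k \<cdot>\<^sub>m outer_prod x e"
      using S[OF q, of S1] by (simp_all only: S1_def)
    have "B_step \<sigma> dt (b \<cdot>\<^sub>v x) (X1 * S1 * transpose_mat V1) B1"
      unfolding u1 B B1_def ..
    with q Sst have "naive_imex nx N dx \<sigma> dt Q M X0 S0 V0 (b \<cdot>\<^sub>v x)
        (X1 * S1 * transpose_mat V1) B1"
      unfolding step by blast
    then show ?thesis by blast
  qed
qed

section \<open>Strict growth of the total energy\<close>

text \<open>The universal clause covers all admissible QR factors; the existence clause keeps it
  from being vacuous. One initial state and one step size serve every choice of factors.\<close>

theorem theorem2: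
  fixes nx N r :: nat and dx \<sigma> :: real and Q M :: "real mat"
  assumes "1 \<le> r" and "2 * r \<le> min nx N"
    and "dx > 0" and "\<sigma> > 0"
    and "orthogonal_diagonalization (angular_mat N) Q M"
  shows "\<exists>u0 X0 S0 V0 B0 dt.
    X0 \<in> carrier_mat nx r \<and> orthonormal_cols X0 \<and>
    S0 \<in> carrier_mat r r \<and>
    V0 \<in> carrier_mat N r \<and> orthonormal_cols V0 \<and>
    u0 = X0 * S0 * transpose_mat V0 \<and>
    B0 \<in> carrier_vec nx \<and>
    dt > 0 \<and>
    (\<exists>u1 B1. naive_imex nx N dx \<sigma> dt Q M X0 S0 V0 B0 u1 B1) \<and>
    (\<forall>u1 B1. naive_imex nx N dx \<sigma> dt Q M X0 S0 V0 B0 u1 B1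
       \<longrightarrow> total_energy u1 B1 > total_energy u0 B0)"
proof -
  \<comment> \<open>The factor 1 / sqrt nx makes the constant vector a unit vector.\<close>
  define x where "x = vec nx (\<lambda>_. 1 / sqrt (real nx))"
  define e where "e = (unit_vec N 0 :: real vec)"
  define S0 where "S0 = outer_prod (unit_vec r 0) (unit_vec r 0 :: real vec)"
  define dt where "dt = 1 / \<sigma>"
  have r: "0 < r" "0 < nx" "0 < N" "2 * r \<le> nx" "2 * r \<le> N" using assms by auto
  have x: "x \<in> carrier_vec nx" and e: "e \<in> carrier_vec N" by (auto simp: x_def e_def)
  have xx: "x \<bullet> x = 1" using r by (simp add: x_def scalar_prod_def)
  have ee: "e \<bullet> e = 1" using r by (simp add: e_def)
  have QM: "Q \<in> carrier_mat N N" "M \<in> carrier_mat N N"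
    using assms(5) by (auto simp: orthogonal_diagonalization_def angular_mat_def)
  \<comment> \<open>The QR property is kept for all k, so the basis is fixed first; k = 3/2 is
    inserted only when existence of a result is shown.\<close>
  obtain X0 where X0: "X0 \<in> carrier_mat nx r" "orthonormal_cols X0" "col X0 0 = x"
    and qX: "\<And>k. \<exists>W. is_qr_factor (append_columns (k \<cdot>\<^sub>m outer_prod x (unit_vec r 0)) X0) W"
    using exists_orthonormal_with_qr_factor[OF x xx assms(1) r(4)] by blast
  obtain V0 where V0: "V0 \<in> carrier_mat N r" "orthonormal_cols V0" "col V0 0 = e"
    and qV: "\<And>k. \<exists>W. is_qr_factor (append_columns (k \<cdot>\<^sub>m outer_prod e (unit_vec r 0)) V0) W"
    using exists_orthonormal_with_qr_factor[OF e ee assms(1) r(5)] by blast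
  have s: "\<sigma> * dt = 1" and dt: "dt > 0" using assms(4) by (auto simp: dt_def)
  have D: "Dx_mat nx dx *\<^sub>v x = 0\<^sub>v nx" "Dxx_mat nx dx *\<^sub>v x = 0\<^sub>v nx"
    by (simp_all add: x_def Dx_mat_const Dxx_mat_const)
  have k: "(3 / 2 :: real) = (1 + \<sigma> * dt * 2) / (1 + \<sigma> * dt)" by (simp add: s)
  note step = naive_imex_equilibrium_direction[OF x D QM X0 V0[unfolded e_def] r(1,3) S0_def _ k,
      folded e_def]
  have u0: "X0 * S0 * transpose_mat V0 = outer_prod x e"
    using step(1) by (simp add: s)
  have ex: "\<exists>u1 B1. naive_imex nx N dx \<sigma> dt Q M X0 S0 V0 (2 \<cdot>\<^sub>v x) u1 B1"
    using step(3) qX[of "3 / 2"] qV[of "3 / 2"] by (auto simp: s)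
  have inc: "total_energy (outer_prod x e) (2 \<cdot>\<^sub>v x) < total_energy u1 B1"
    if "naive_imex nx N dx \<sigma> dt Q M X0 S0 V0 (2 \<cdot>\<^sub>v x) u1 B1" for u1 B1
  proof -
    have u1: "u1 = (3 / 2) \<cdot>\<^sub>m outer_prod x e" and B1: "B1 = (7 / 4) \<cdot>\<^sub>v x"
      using step(2)[OF _ that] by (simp_all add: s)
    have E: "total_energy (k \<cdot>\<^sub>m outer_prod x e) (b \<cdot>\<^sub>v x) = k\<^sup>2 / 2 + b\<^sup>2 / 2" for k b
      by (simp add: total_energy_def frobenius_norm_outer_prod euclidean_norm_smult xx ee)
    \<comment> \<open>The scalar 1 brings the initial state into the form of \<open>E\<close>. The
      energies are then 5/2 before the step and 9/8 + 49/32 = 85/32 after it.\<close>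
    have "1 \<cdot>\<^sub>m outer_prod x e = outer_prod x e" by (rule eq_matI) auto
    then show ?thesis
      using E[of 1 2] by (simp add: u1 B1 E power2_eq_square)
  qed
  have "S0 \<in> carrier_mat r r" "2 \<cdot>\<^sub>v x \<in> carrier_vec nx" using x by (auto simp: S0_def)
  then have "X0 \<in> carrier_mat nx r \<and> orthonormal_cols X0 \<and> S0 \<in> carrier_mat r r \<and>
    V0 \<in> carrier_mat N r \<and> orthonormal_cols V0 \<and>
    outer_prod x e = X0 * S0 * transpose_mat V0 \<and> 2 \<cdot>\<^sub>v x \<in> carrier_vec nx \<and> dt > 0 \<and>
    (\<exists>u1 B1. naive_imex nx N dx \<sigma> dt Q M X0 S0 V0 (2 \<cdot>\<^sub>v x) u1 B1) \<and>
    (\<forall>u1 B1. naive_imex nx N dx \<sigma> dt Q M X0 S0 V0 (2 \<cdot>\<^sub>v x) u1 B1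
       \<longrightarrow> total_energy u1 B1 > total_energy (outer_prod x e) (2 \<cdot>\<^sub>v x))"
    using X0(1,2) V0(1,2) ex inc dt u0[symmetric] by (intro conjI allI impI) simp_all
  then show ?thesis
    by (intro exI[of _ "outer_prod x e"] exI[of _ X0] exI[of _ S0] exI[of _ V0]
        exI[of _ "2 \<cdot>\<^sub>v x"] exI[of _ dt])
qed

end
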